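(* Consider a multilayer network with nodes $i,j\in\{1,\dots,N\}$ and layers $s,r\in\{1,\dots,l\}$, with within-layer adjacency $A_{ijs}\in\{0,1\}$ and couplings $C_{isr}\in\{0,1\}$. Let $\upsilon$ be a community labelling and let the linking probabilities $P(\upsilon_{is},\upsilon_{jr})$ lie in $[0,1]$. Let $$\mathcal{L}(\mathbf A,\mathbf C\mid\mathbf P)=\prod_{i\neq j,\,s}P(\upsilon_{is},\upsilon_{js})^{A_{ijs}}[1-P(\upsilon_{is},\upsilon_{js})]^{1-A_{ijs}}\prod_{s\neq r,\,i}P(\upsilon_{is},\upsilon_{ir})^{C_{isr}}[1-P(\upsilon_{is},\upsilon_{ir})]^{1-C_{isr}}$$ be the likelihood of the multilayer stochastic blockmodel, so that $$\begin{aligned}\log\mathcal{L}(\mathbf A,\mathbf C\mid\mathbf P)=&\sum_{i\neq j,\,s}A_{ijs}\log P(\upsilon_{is},\upsilon_{js})+\sum_{i\neq j,\,s}(1-A_{ijs})\log[1-P(\upsilon_{is},\upsilon_{js})]\\&+\sum_{s\neq r,\,i}C_{isr}\log P(\upsilon_{is},\upsilon_{ir})+\sum_{s\neq r,\,i}(1-C_{isr})\log[1-P(\upsilon_{is},\upsilon_{ir})].\end{aligned}$$ In the multilayer edge mixture objective $\mathcal{M}(\upsilon)$ (defined in the context), omit the terms with weights $b,c,f,g$, take the signs $\lambda_a=\lambda_d=\lambda_e=\lambda_h=+1$, and choose $$a_{ijs}=\frac{\log P(\upsilon_{is},\upsilon_{js})}{P(\upsilon_{is},\upsilon_{js})},\quad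 d_{ijs}=\frac{\log[1-P(\upsilon_{is},\upsilon_{js})]}{1-P(\upsilon_{is},\upsilon_{js})},\quad e_{isr}=\frac{\log P(\upsilon_{is},\upsilon_{ir})}{P(\upsilon_{is},\upsilon_{ir})},\quad h_{isr}=\frac{\log[1-P(\upsilon_{is},\upsilon_{ir})]}{1-P(\upsilon_{is},\upsilon_{ir})}.$$ Then $\mathcal{M}(\upsilon)$ is equivalent to the log-likelihood: $\mathcal{M}(\upsilon)=\log\mathcal{L}(\mathbf A,\mathbf C\mid\mathbf P)$. Moreover, this choice of hyper parameters satisfies the sufficient condition for being discriminative recalled in the context, with $F_1(x)=\frac{\log x}{x}$: the probabilities lie in $[0,1]$, the function $\frac{\log x}{x}$ is continuous and monotonically increasing in $(0,1]$, and the maximum of these weights equals $0$, when the corresponding probability equals $1$.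
   Context: All $l$ layers share the same set of $N$ nodes; $A_{ijs}$ is the adjacency of nodes $i,j$ in layer $s$, and $C_{isr}$ the coupling between the copies of node $i$ in layers $s$ and $r$. A community labelling $\upsilon$ assigns to each pair (node $i$, layer $s$) a community label $\upsilon_{is}$, and $P(\upsilon_{is},\upsilon_{jr})$ is the linking probability between the corresponding communities. The multilayer edge mixture (MEMM) objective with signs $\lambda_a,\dots,\lambda_h\in\{+1,-1\}$ and hyper parameters $a_{ijs},b_{ijs},c_{ijs},d_{ijs},e_{isr},f_{isr},g_{isr},h_{isr}$ is $$\begin{aligned}\mathcal{M}(\upsilon)=&\sum_{i\neq j,\,s}\Big(\lambda_a a_{ijs}A_{ijs}P(\upsilon_{is},\upsilon_{js})+\lambda_b b_{ijs}(1-A_{ijs})P(\upsilon_{is},\upsilon_{js})\\&\qquad+\lambda_c c_{ijs}A_{ijs}[1-P(\upsilon_{is},\upsilon_{js})]+\lambda_d d_{ijs}(1-A_{ijs})[1-P(\upsilon_{is},\upsilon_{js})]\Big)\\&+\sum_{s\ne r,\,i}\Big(\lambda_e e_{isr}C_{isr}P(\upsilon_{is},\upsilon_{ir})+\lambda_f f_{isr}(1-C_{isr})P(\upsilon_{is},\upsilon_{ir})\\&\qquad+\lambda_g g_{isr}C_{isr}[1-P(\upsilon_{is},\upsilon_{ir})]+\lambda_h h_{isr}(1-C_{isr})[1-P(\upsilon_{is},\upsilon_{ir})]\Big).\end{aligned}$$ A hyper parameter set is called discriminative if for any two of its weights $\omega_1,\omega_2$ the ratio of the maxima of $\lambda_{\omega_1}\omega_1$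 and $\lambda_{\omega_2}\omega_2$ tends to $1$. Sufficient condition: $F_1,F_2$ are continuous monotonically increasing functions with $F_1(U)=F_2(L)$, and each weight $\omega_i$ is $F_1(x_i)$ if its sign is $+1$ and $F_2(x_i)$ otherwise, with $x_i\in[L,U]$.
   Formalization: The equality M = log L is stated when the likelihood is nonzero; if it is zero, M contains the undefined product (log 0/0)·0, and M is then read as a limit from linking probabilities in (0,1). At probability 0, log x/x is taken as minus infinity. *)

theory Defs
  imports "HOL-Analysis.Analysis" "HOL-Library.Extended_Real"
begin

(* Nodes are {1..N}, layers are {1..l}.  Both sums of the objective run over ordered pairs:
   (i, j, s) with i \<noteq> j, and (i, s, r) with s \<noteq> r. *)

definition intra_index :: "nat \<Rightarrow> nat \<Rightarrow> (nat \<times> nat \<times> nat) set" where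
  "intra_index N l = {(i, j, s). i \<in> {1..N} \<and> j \<in> {1..N} \<and> i \<noteq> j \<and> s \<in> {1..l}}"

definition inter_index :: "nat \<Rightarrow> nat \<Rightarrow> (nat \<times> nat \<times> nat) set" where
  "inter_index N l = {(i, s, r). i \<in> {1..N} \<and> s \<in> {1..l} \<and> r \<in> {1..l} \<and> s \<noteq> r}"

definition linking_probs_in ::
  "real set \<Rightarrow> nat \<Rightarrow> nat \<Rightarrow> (nat \<Rightarrow> nat \<Rightarrow> 'c) \<Rightarrow> ('c \<Rightarrow> 'c \<Rightarrow> real) \<Rightarrow> bool" where
  "linking_probs_in S N l \<upsilon> P \<longleftrightarrow>
     (\<forall>i\<in>{1..N}. \<forall>j\<in>{1..N}. \<forall>s\<in>{1..l}. \<forall>r\<in>{1..l}. P (\<upsilon> i s) (\<upsilon> j r) \<in> S)"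

record memm_signs =
  lam_a :: real  lam_b :: real  lam_c :: real  lam_d :: real
  lam_e :: real  lam_f :: real  lam_g :: real  lam_h :: real

(* Weights take extended real values because log p / p is -\<infinity> at p = 0.  Note that
   multiplication on ereal satisfies 0 * \<infinity> = 0. *)
record memm_weights =
  wt_a :: "nat \<Rightarrow> nat \<Rightarrow> nat \<Rightarrow> ereal"
  wt_b :: "nat \<Rightarrow> nat \<Rightarrow> nat \<Rightarrow> ereal"
  wt_c :: "nat \<Rightarrow> nat \<Rightarrow> nat \<Rightarrow> ereal"
  wt_d :: "nat \<Rightarrow> nat \<Rightarrow> nat \<Rightarrow> ereal"
  wt_e :: "nat \<Rightarrow> nat \<Rightarrow> nat \<Rightarrow> ereal"
  wt_f :: "nat \<Rightarrow> nat \<Rightarrow> nat \<Rightarrow> ereal"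
  wt_g :: "nat \<Rightarrow> nat \<Rightarrow> nat \<Rightarrow> ereal"
  wt_h :: "nat \<Rightarrow> nat \<Rightarrow> nat \<Rightarrow> ereal"

definition memm ::
  "memm_signs \<Rightarrow> memm_weights \<Rightarrow> nat \<Rightarrow> nat \<Rightarrow> (nat \<Rightarrow> nat \<Rightarrow> nat \<Rightarrow> nat) \<Rightarrow>
   (nat \<Rightarrow> nat \<Rightarrow> nat \<Rightarrow> nat) \<Rightarrow> ('c \<Rightarrow> 'c \<Rightarrow> real) \<Rightarrow> (nat \<Rightarrow> nat \<Rightarrow> 'c) \<Rightarrow> ereal" where
  "memm \<sigma> w N l A C P \<upsilon> =
     (\<Sum>(i, j, s)\<in>intra_index N l.
         ereal (lam_a \<sigma>) * wt_a w i j s * ereal (real (A i j s)) * ereal (P (\<upsilon> i s) (\<upsilon> j s))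
       + ereal (lam_b \<sigma>) * wt_b w i j s * ereal (1 - real (A i j s)) * ereal (P (\<upsilon> i s) (\<upsilon> j s))
       + ereal (lam_c \<sigma>) * wt_c w i j s * ereal (real (A i j s)) * ereal (1 - P (\<upsilon> i s) (\<upsilon> j s))
       + ereal (lam_d \<sigma>) * wt_d w i j s * ereal (1 - real (A i j s)) * ereal (1 - P (\<upsilon> i s) (\<upsilon> j s)))
   + (\<Sum>(i, s, r)\<in>inter_index N l.
         ereal (lam_e \<sigma>) * wt_e w i s r * ereal (real (C i s r)) * ereal (P (\<upsilon> i s) (\<upsilon> i r))
       + ereal (lam_f \<sigma>) * wt_f w i s r * ereal (1 - real (C i s r)) * ereal (P (\<upsilon> i s) (\<upsilon> i r))
       + ereal (lam_g \<sigma>) * wt_g w i s r * ereal (real (C i s r)) * ereal (1 - P (\<upsilon> i s) (\<upsilon> i r))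
       + ereal (lam_h \<sigma>) * wt_h w i s r * ereal (1 - real (C i s r)) * ereal (1 - P (\<upsilon> i s) (\<upsilon> i r)))"

(* Only used on [0, \<infinity>).  The library's ln sends 0 to 0, which is wrong for likelihoods. *)
definition ext_ln :: "real \<Rightarrow> ereal" where
  "ext_ln x = (if x \<le> 0 then -\<infinity> else ereal (ln x))"

(* At x = 0 ereal division gives -\<infinity> / 0 = -\<infinity>, which is the limit of ln x / x
   as x decreases to 0. *)
definition log_ratio :: "real \<Rightarrow> ereal" where
  "log_ratio x = ext_ln x / ereal x"

definition sbm_weights :: "('c \<Rightarrow> 'c \<Rightarrow> real) \<Rightarrow> (nat \<Rightarrow> nat \<Rightarrow> 'c) \<Rightarrow> memm_weights" where
  "sbm_weights P \<upsilon> =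
     \<lparr> wt_a = (\<lambda>i j s. log_ratio (P (\<upsilon> i s) (\<upsilon> j s))),
       wt_b = (\<lambda>i j s. 0),
       wt_c = (\<lambda>i j s. 0),
       wt_d = (\<lambda>i j s. log_ratio (1 - P (\<upsilon> i s) (\<upsilon> j s))),
       wt_e = (\<lambda>i s r. log_ratio (P (\<upsilon> i s) (\<upsilon> i r))),
       wt_f = (\<lambda>i s r. 0),
       wt_g = (\<lambda>i s r. 0),
       wt_h = (\<lambda>i s r. log_ratio (1 - P (\<upsilon> i s) (\<upsilon> i r))) \<rparr>"

(* A and C are natural-number valued so that 0 ^ 0 = 1 is available; this fails for powr. *)
definition likelihood ::
  "nat \<Rightarrow> nat \<Rightarrow> (nat \<Rightarrow> nat \<Rightarrow> nat \<Rightarrow> nat) \<Rightarrow> (nat \<Rightarrow> nat \<Rightarrow> nat \<Rightarrow> nat) \<Rightarrow>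
   ('c \<Rightarrow> 'c \<Rightarrow> real) \<Rightarrow> (nat \<Rightarrow> nat \<Rightarrow> 'c) \<Rightarrow> real" where
  "likelihood N l A C P \<upsilon> =
     (\<Prod>(i, j, s)\<in>intra_index N l.
        P (\<upsilon> i s) (\<upsilon> j s) ^ A i j s * (1 - P (\<upsilon> i s) (\<upsilon> j s)) ^ (1 - A i j s))
   * (\<Prod>(i, s, r)\<in>inter_index N l.
        P (\<upsilon> i s) (\<upsilon> i r) ^ C i s r * (1 - P (\<upsilon> i s) (\<upsilon> i r)) ^ (1 - C i s r))"

(* A hyper parameter set is presented as the set of pairs (sign, value) of its weights. *)
definition signed_weights ::
  "(nat \<times> nat \<times> nat) set \<Rightarrow> real \<Rightarrow> (nat \<Rightarrow> nat \<Rightarrow> nat \<Rightarrow> ereal) \<Rightarrow> (real \<times> ereal) set" where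
  "signed_weights I lam \<omega> = (\<lambda>(x, y, z). (lam, \<omega> x y z)) ` I"

(* The hyper parameters left after omitting the terms with weights b, c, f, g. *)
definition retained_weights ::
  "nat \<Rightarrow> nat \<Rightarrow> memm_signs \<Rightarrow> memm_weights \<Rightarrow> (real \<times> ereal) set" where
  "retained_weights N l \<sigma> w =
     signed_weights (intra_index N l) (lam_a \<sigma>) (wt_a w) \<union>
     signed_weights (intra_index N l) (lam_d \<sigma>) (wt_d w) \<union>
     signed_weights (inter_index N l) (lam_e \<sigma>) (wt_e w) \<union>
     signed_weights (inter_index N l) (lam_h \<sigma>) (wt_h w)"

definition discriminative_condition ::
  "(real \<Rightarrow> ereal) \<Rightarrow> (real \<Rightarrow> ereal) \<Rightarrow> real \<Rightarrow> real \<Rightarrow> (real \<times> ereal) set \<Rightarrow> bool" where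
  "discriminative_condition F1 F2 L U W \<longleftrightarrow>
     L < U \<and>
     continuous_on {L..U} F1 \<and> strict_mono_on {L..U} F1 \<and>
     continuous_on {L..U} F2 \<and> strict_mono_on {L..U} F2 \<and>
     F1 U = F2 L \<and>
     (\<forall>(lam, \<omega>)\<in>W. \<exists>x\<in>{L..U}. \<omega> = (if lam = 1 then F1 x else F2 x))"

end

theory Submission
  imports Defs
begin

(* Extending the logarithm by ln 0 = -\<infinity> makes it a continuous map on the reals that turns
   products of nonnegative reals into sums of extended reals, which gives the log-likelihood identity.
   Each summand of the objective is ln p / p * p = ln p unless p = 0, so objective and log-likelihood
   agree off the zero set of the likelihood, and the limit statement follows by continuity. *)

section \<open>The extended logarithm on the reals\<close>

lemma ext_ln_one [simp]: "ext_ln 1 = 0"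
  by (simp add: ext_ln_def)

lemma ext_ln_pos: "0 < x \<Longrightarrow> ext_ln x = ereal (ln x)"
  by (simp add: ext_ln_def)

text \<open>A vanishing factor makes both sides \<open>-\<infinity>\<close>: since
  \<open>ext_ln\<close> never takes the value \<open>\<infinity>\<close>, the sum on the right is
  never of the indeterminate form.\<close>

lemma ext_ln_mult:
  assumes "0 \<le> x" "0 \<le> y"
  shows "ext_ln (x * y) = ext_ln x + ext_ln y"
  using assms by (auto simp: ext_ln_def ln_mult mult_le_0_iff)

lemma ext_ln_prod:
  assumes "\<And>k. k \<in> I \<Longrightarrow> 0 \<le> f k"
  shows "ext_ln (prod f I) = (\<Sum>k\<in>I. ext_ln (f k))"
  using assms
  by (induction I rule: infinite_finite_induct) (simp_all add: ext_ln_mult prod_nonneg)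

text \<open>Near a positive point \<open>ext_ln\<close> is the ordinary logarithm. On the whole
  half-line of nonpositive reals it is \<open>-\<infinity>\<close>, and for every real r it drops
  below r on all of y < exp r, a neighbourhood of each such point. Hence continuity is two-sided
  even at 0.\<close>

lemma isCont_ext_ln: "isCont ext_ln x"
proof (cases "0 < x")
  case True
  have "((\<lambda>y. ereal (ln y)) \<longlongrightarrow> ereal (ln x)) (at x)"
    using True by (intro tendsto_intros) auto
  moreover have "eventually (\<lambda>y. ereal (ln y) = ext_ln y) (at x)"
    using order_tendstoD(1)[OF tendsto_ident_at True]
    by eventually_elim (simp add: ext_ln_pos)
  ultimately have "(ext_ln \<longlongrightarrow> ereal (ln x)) (at x)"
    by (rule Lim_transform_eventually)
  then show ?thesis
    using True by (simp add: isCont_def ext_ln_pos)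
next
  case False
  have "(ext_ln \<longlongrightarrow> -\<infinity>) (at x)"
    unfolding tendsto_MInfty
  proof
    fix r :: real
    have "x < exp r"
      using False by (meson exp_gt_zero not_less order_le_less_trans)
    from order_tendstoD(2)[OF tendsto_ident_at this]
    show "eventually (\<lambda>y. ext_ln y < ereal r) (at x)"
    proof eventually_elim
      case (elim y)
      then have "ln y < r" if "0 < y"
        using that by (metis exp_less_cancel_iff exp_ln)
      then show ?case
        by (simp add: ext_ln_def)
    qed
  qed
  then show ?thesis
    using False by (simp add: isCont_def ext_ln_def)
qed

section \<open>The weight function log x / x on the unit interval\<close>

lemma log_ratio_pos: "0 < x \<Longrightarrow> log_ratio x = ereal (ln x / x)"
  by (simp add: log_ratio_def ext_ln_pos)

lemma log_ratio_zero [simp]: "log_ratio 0 = -\<infinity>"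
  by (simp add: log_ratio_def ext_ln_def divide_ereal_def)

lemma log_ratio_one [simp]: "log_ratio 1 = 0"
  by (simp add: log_ratio_pos)

text \<open>Positivity is essential: at 0 the left side is \<open>-\<infinity>\<close> times 0,
  which \<open>ereal\<close> evaluates to 0, whereas \<open>ext_ln 0\<close> is
  \<open>-\<infinity>\<close>. This is the source of the nonvanishing condition on the
  likelihood.\<close>

lemma log_ratio_mult:
  assumes "0 < x"
  shows "log_ratio x * ereal x = ext_ln x"
  using assms by (simp add: log_ratio_pos ext_ln_pos)

lemma strict_mono_on_ln_div: "strict_mono_on {0<..1} (\<lambda>x::real. ln x / x)"
proof (rule strict_mono_onI)
  fix x y :: real
  assume x: "x \<in> {0<..1}" and y: "y \<in> {0<..1}" and "x < y"
  then have "ln x / x < ln y / x"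
    by (simp add: divide_strict_right_mono)
  \<comment> \<open>The numerator is nonpositive on (0, 1], so enlarging the denominator raises the
    quotient.\<close>
  also have "\<dots> \<le> ln y / y"
    using x y \<open>x < y\<close> by (intro divide_left_mono_neg) auto
  finally show "ln x / x < ln y / y" .
qed

lemma continuous_on_ln_div: "continuous_on {0<..1} (\<lambda>x::real. ln x / x)"
  by (auto intro!: continuous_intros)

lemma strict_mono_on_log_ratio: "strict_mono_on {0..1} log_ratio"
proof (rule strict_mono_onI)
  fix x y :: real
  assume "x \<in> {0..1}" "y \<in> {0..1}" "x < y"
  then show "log_ratio x < log_ratio y"
    using strict_mono_onD[OF strict_mono_on_ln_div, of x y]
    by (cases "x = 0") (simp_all add: log_ratio_pos)
qed

text \<open>Dividing the nonpositive ln x by a number at most 1 can only lower it. The bound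
  controls \<open>log_ratio\<close> near 0 by a function whose limit is already known.\<close>

lemma log_ratio_le_ext_ln:
  assumes "0 \<le> x" "x \<le> 1"
  shows "log_ratio x \<le> ext_ln x"
proof (cases "x = 0")
  case False
  then have "ln x / x \<le> ln x / 1"
    using assms by (intro divide_left_mono_neg) auto
  then show ?thesis
    using assms False by (simp add: log_ratio_pos ext_ln_pos)
qed simp

lemma continuous_on_log_ratio: "continuous_on {0..1} log_ratio"
  unfolding continuous_on_def
proof
  fix x :: real
  assume x: "x \<in> {0..1}"
  show "(log_ratio \<longlongrightarrow> log_ratio x) (at x within {0..1})"
  proof (cases "x = 0")
    case True
    have "(ext_ln \<longlongrightarrow> -\<infinity>) (at 0 within {0..1})"
      using isCont_ext_ln[of 0] tendsto_within_subset[of ext_ln _ 0 UNIV]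
      by (simp add: isCont_def ext_ln_def)
    \<comment> \<open>Sandwich between the constant \<open>-\<infinity>\<close> and
      \<open>ext_ln\<close>, both of which tend to \<open>-\<infinity>\<close> at 0 from within the
      interval.\<close>
    then have "(log_ratio \<longlongrightarrow> -\<infinity>) (at 0 within {0..1})"
      by (rule tendsto_sandwich[OF _ _ tendsto_const, rotated 2])
        (auto simp: eventually_at_filter log_ratio_le_ext_ln)
    then show ?thesis
      using True by simp
  next
    case False
    then have "0 < x"
      using x by simp
    have "((\<lambda>y. ereal (ln y / y)) \<longlongrightarrow> ereal (ln x / x)) (at x within {0..1})"
      using \<open>0 < x\<close> by (intro tendsto_intros) auto
    moreover have "eventually (\<lambda>y. ereal (ln y / y) = log_ratio y) (at x within {0..1})"
      using order_tendstoD(1)[OF tendsto_ident_at \<open>0 < x\<close>]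
      by eventually_elim (simp add: log_ratio_pos)
    ultimately show ?thesis
      unfolding log_ratio_pos[OF \<open>0 < x\<close>] by (rule Lim_transform_eventually)
  qed
qed

lemma log_ratio_nonpos:
  assumes "x \<in> {0..1}"
  shows "log_ratio x \<le> 0 \<and> (log_ratio x = 0 \<longleftrightarrow> x = 1)"
  using assms strict_mono_onD[OF strict_mono_on_log_ratio, of x 1] by (cases "x = 1") auto

section \<open>Bernoulli factors, shared by within-layer edges and couplings\<close>

definition edge_lik :: "nat \<Rightarrow> real \<Rightarrow> real" where
  "edge_lik a p = p ^ a * (1 - p) ^ (1 - a)"

lemma edge_lik_nonneg: "p \<in> {0..1} \<Longrightarrow> 0 \<le> edge_lik a p"
  by (simp add: edge_lik_def)

lemma tendsto_edge_lik:
  "(f \<longlongrightarrow> p) F \<Longrightarrow> ((\<lambda>n. edge_lik a (f n)) \<longlongrightarrow> edge_lik a p) F"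
  unfolding edge_lik_def by (intro tendsto_intros)

text \<open>The convention 0 * \<open>\<infinity>\<close> = 0 on \<open>ereal\<close> suppresses the
  term with exponent 0, just as 0 ^ 0 = 1 does in the product, so p = 0 and p = 1 need no exclusion
  here.\<close>

lemma ext_ln_edge_lik:
  assumes "a \<in> {0, 1}"
  shows "ext_ln (edge_lik a p) = ereal (real a) * ext_ln p + ereal (1 - real a) * ext_ln (1 - p)"
  using assms by (auto simp: edge_lik_def simp flip: zero_ereal_def)

text \<open>The nonvanishing factor rules out exactly a = 1, p = 0 and a = 0, p = 1, the cases where
  the selected term is \<open>-\<infinity>\<close> times 0. In the unselected term the coefficient 0
  absorbs the weight, even an infinite one. The shape copies a summand of \<open>memm\<close>, with
  \<mu> and \<nu> standing for the signs of the omitted terms, so that it rewrites both sums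
  directly.\<close>

lemma memm_summand:
  assumes "a \<in> {0, 1}" "p \<in> {0..1}" "edge_lik a p \<noteq> 0"
  shows "ereal 1 * log_ratio p * ereal (real a) * ereal p
       + ereal \<mu> * 0 * ereal (1 - real a) * ereal p
       + ereal \<nu> * 0 * ereal (real a) * ereal (1 - p)
       + ereal 1 * log_ratio (1 - p) * ereal (1 - real a) * ereal (1 - p) = ext_ln (edge_lik a p)"
  using assms log_ratio_mult[of p] log_ratio_mult[of "1 - p"]
  by (auto simp: edge_lik_def simp flip: zero_ereal_def one_ereal_def)

lemma likelihood_alt:
  "likelihood N l A C P \<upsilon> =
     (\<Prod>(i, j, s)\<in>intra_index N l. edge_lik (A i j s) (P (\<upsilon> i s) (\<upsilon> j s)))
   * (\<Prod>(i, s, r)\<in>inter_index N l. edge_lik (C i s r) (P (\<upsilon> i s) (\<upsilon> i r)))"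
  by (simp add: likelihood_def edge_lik_def)

section \<open>From single factors to the whole network\<close>

lemma finite_intra_index: "finite (intra_index N l)"
  by (rule finite_subset[of _ "{1..N} \<times> {1..N} \<times> {1..l}"]) (auto simp: intra_index_def)

lemma finite_inter_index: "finite (inter_index N l)"
  by (rule finite_subset[of _ "{1..N} \<times> {1..l} \<times> {1..l}"]) (auto simp: inter_index_def)

lemma linking_probs_intra:
  "linking_probs_in S N l \<upsilon> P \<Longrightarrow> (i, j, s) \<in> intra_index N l \<Longrightarrow> P (\<upsilon> i s) (\<upsilon> j s) \<in> S"
  by (simp add: linking_probs_in_def intra_index_def)

lemma linking_probs_inter:
  "linking_probs_in S N l \<upsilon> P \<Longrightarrow> (i, s, r) \<in> inter_index N l \<Longrightarrow> P (\<upsilon> i s) (\<upsilon> i r) \<in> S"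
  by (simp add: linking_probs_in_def inter_index_def)

lemma linking_probs_mono:
  "linking_probs_in S N l \<upsilon> P \<Longrightarrow> S \<subseteq> T \<Longrightarrow> linking_probs_in T N l \<upsilon> P"
  by (auto simp: linking_probs_in_def)

lemma ext_ln_likelihood:
  assumes "linking_probs_in {0..1} N l \<upsilon> P"
  shows "ext_ln (likelihood N l A C P \<upsilon>) =
     (\<Sum>(i, j, s)\<in>intra_index N l. ext_ln (edge_lik (A i j s) (P (\<upsilon> i s) (\<upsilon> j s))))
   + (\<Sum>(i, s, r)\<in>inter_index N l. ext_ln (edge_lik (C i s r) (P (\<upsilon> i s) (\<upsilon> i r))))"
proof -
  let ?f = "\<lambda>(i, j, s). edge_lik (A i j s) (P (\<upsilon> i s) (\<upsilon> j s))"
  let ?g = "\<lambda>(i, s, r). edge_lik (C i s r) (P (\<upsilon> i s) (\<upsilon> i r))"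
  have f: "0 \<le> ?f k" if "k \<in> intra_index N l" for k
    using that linking_probs_intra[OF assms] by (auto intro: edge_lik_nonneg split: prod.split)
  have g: "0 \<le> ?g k" if "k \<in> inter_index N l" for k
    using that linking_probs_inter[OF assms] by (auto intro: edge_lik_nonneg split: prod.split)
  have "ext_ln (likelihood N l A C P \<upsilon>)
      = ext_ln (prod ?f (intra_index N l)) + ext_ln (prod ?g (inter_index N l))"
    unfolding likelihood_alt by (intro ext_ln_mult prod_nonneg ballI f g)
  also have "\<dots> = (\<Sum>k\<in>intra_index N l. ext_ln (?f k)) + (\<Sum>k\<in>inter_index N l. ext_ln (?g k))"
    by (simp only: ext_ln_prod f g)
  finally show ?thesis
    by (simp only: case_prod_unfold)
qed

lemma ext_ln_likelihood_expand:
  assumes A: "\<And>i j s. (i, j, s) \<in> intra_index N l \<Longrightarrow> A i j s \<in> {0, 1}"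
    and C: "\<And>i s r. (i, s, r) \<in> inter_index N l \<Longrightarrow> C i s r \<in> {0, 1}"
    and P: "linking_probs_in {0..1} N l \<upsilon> P"
  shows "ext_ln (likelihood N l A C P \<upsilon>) =
        (\<Sum>(i, j, s)\<in>intra_index N l. ereal (real (A i j s)) * ext_ln (P (\<upsilon> i s) (\<upsilon> j s)))
      + (\<Sum>(i, j, s)\<in>intra_index N l. ereal (1 - real (A i j s)) * ext_ln (1 - P (\<upsilon> i s) (\<upsilon> j s)))
      + (\<Sum>(i, s, r)\<in>inter_index N l. ereal (real (C i s r)) * ext_ln (P (\<upsilon> i s) (\<upsilon> i r)))
      + (\<Sum>(i, s, r)\<in>inter_index N l. ereal (1 - real (C i s r)) * ext_ln (1 - P (\<upsilon> i s) (\<upsilon> i r)))"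
proof -
  have "(\<Sum>(i, j, s)\<in>intra_index N l. ext_ln (edge_lik (A i j s) (P (\<upsilon> i s) (\<upsilon> j s))))
      = (\<Sum>(i, j, s)\<in>intra_index N l. ereal (real (A i j s)) * ext_ln (P (\<upsilon> i s) (\<upsilon> j s)))
      + (\<Sum>(i, j, s)\<in>intra_index N l. ereal (1 - real (A i j s)) * ext_ln (1 - P (\<upsilon> i s) (\<upsilon> j s)))"
    \<comment> \<open>Addition on \<open>ereal\<close> is associative and commutative without
      restriction, so regrouping the sums is sound also when some terms are
      \<open>-\<infinity>\<close>.\<close>
    unfolding sum.distrib[symmetric]
    by (intro sum.cong refl) (clarsimp simp only: split_beta fst_conv snd_conv ext_ln_edge_lik[OF A])
  moreover have "(\<Sum>(i, s, r)\<in>inter_index N l. ext_ln (edge_lik (C i s r) (P (\<upsilon> i s) (\<upsilon> i r))))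
      = (\<Sum>(i, s, r)\<in>inter_index N l. ereal (real (C i s r)) * ext_ln (P (\<upsilon> i s) (\<upsilon> i r)))
      + (\<Sum>(i, s, r)\<in>inter_index N l. ereal (1 - real (C i s r)) * ext_ln (1 - P (\<upsilon> i s) (\<upsilon> i r)))"
    unfolding sum.distrib[symmetric]
    by (intro sum.cong refl) (clarsimp simp only: split_beta fst_conv snd_conv ext_ln_edge_lik[OF C])
  ultimately show ?thesis
    unfolding ext_ln_likelihood[OF P] by (simp only: add.assoc)
qed

lemma memm_sbm_weights:
  assumes A: "\<And>i j s. (i, j, s) \<in> intra_index N l \<Longrightarrow> A i j s \<in> {0, 1}"
    and C: "\<And>i s r. (i, s, r) \<in> inter_index N l \<Longrightarrow> C i s r \<in> {0, 1}"
    and P: "linking_probs_in {0..1} N l \<upsilon> P"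
    and signs: "lam_a \<sigma> = 1" "lam_d \<sigma> = 1" "lam_e \<sigma> = 1" "lam_h \<sigma> = 1"
    and nz: "likelihood N l A C P \<upsilon> \<noteq> 0"
  shows "memm \<sigma> (sbm_weights P \<upsilon>) N l A C P \<upsilon> = ext_ln (likelihood N l A C P \<upsilon>)"
proof -
  \<comment> \<open>A nonzero product over a finite index set has no zero factor; the global
    condition thus becomes the condition on each summand required by
    \<open>memm_summand\<close>.\<close>
  have A_nz: "edge_lik (A i j s) (P (\<upsilon> i s) (\<upsilon> j s)) \<noteq> 0" if "(i, j, s) \<in> intra_index N l" for i j s
    using nz that by (auto simp: likelihood_alt prod_zero_iff finite_intra_index)
  have C_nz: "edge_lik (C i s r) (P (\<upsilon> i s) (\<upsilon> i r)) \<noteq> 0" if "(i, s, r) \<in> inter_index N l" for i s r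
    using nz that by (auto simp: likelihood_alt prod_zero_iff finite_inter_index)
  show ?thesis
    unfolding ext_ln_likelihood[OF P] memm_def sbm_weights_def memm_weights.select_convs signs
    by (intro arg_cong2[where f = "(+)"] sum.cong refl)
      (clarsimp simp only: split_beta fst_conv snd_conv
         memm_summand[OF A linking_probs_intra[OF P] A_nz]
         memm_summand[OF C linking_probs_inter[OF P] C_nz])+
qed

section \<open>Approximation by linking probabilities in the open unit interval\<close>

lemma tendsto_likelihood:
  assumes "\<forall>i\<in>{1..N}. \<forall>j\<in>{1..N}. \<forall>s\<in>{1..l}. \<forall>r\<in>{1..l}.
     ((\<lambda>n. Q n (\<upsilon> i s) (\<upsilon> j r)) \<longlongrightarrow> P (\<upsilon> i s) (\<upsilon> j r)) F"
  shows "((\<lambda>n. likelihood N l A C (Q n) \<upsilon>) \<longlongrightarrow> likelihood N l A C P \<upsilon>) F"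
  unfolding likelihood_alt using assms
  by (intro tendsto_mult tendsto_prod)
    (auto simp: intra_index_def inter_index_def intro!: tendsto_edge_lik)

lemma likelihood_nonzero:
  assumes "linking_probs_in {0<..<1} N l \<upsilon> P"
  shows "likelihood N l A C P \<upsilon> \<noteq> 0"
proof -
  have "edge_lik a p \<noteq> 0" if "p \<in> {0<..<1}" for a p
    using that by (simp add: edge_lik_def)
  then show ?thesis
    using linking_probs_intra[OF assms] linking_probs_inter[OF assms]
    by (fastforce simp: likelihood_alt finite_intra_index finite_inter_index)
qed

text \<open>Interior probabilities give a nonzero likelihood, so the exact identity holds for every
  \<open>Q n\<close>. The likelihood is polynomial in the probabilities and \<open>ext_ln\<close> is
  continuous also at 0, so the limit is correct even when the limiting likelihood vanishes.\<close>

lemma tendsto_memm_sbm_weights: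
  assumes A: "\<And>i j s. (i, j, s) \<in> intra_index N l \<Longrightarrow> A i j s \<in> {0, 1}"
    and C: "\<And>i s r. (i, s, r) \<in> inter_index N l \<Longrightarrow> C i s r \<in> {0, 1}"
    and signs: "lam_a \<sigma> = 1" "lam_d \<sigma> = 1" "lam_e \<sigma> = 1" "lam_h \<sigma> = 1"
    and Q: "\<forall>n. linking_probs_in {0<..<1} N l \<upsilon> (Q n)"
    and lim: "\<forall>i\<in>{1..N}. \<forall>j\<in>{1..N}. \<forall>s\<in>{1..l}. \<forall>r\<in>{1..l}.
      ((\<lambda>n. Q n (\<upsilon> i s) (\<upsilon> j r)) \<longlongrightarrow> P (\<upsilon> i s) (\<upsilon> j r)) F"
  shows "((\<lambda>n. memm \<sigma> (sbm_weights (Q n) \<upsilon>) N l A C (Q n) \<upsilon>)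
    \<longlongrightarrow> ext_ln (likelihood N l A C P \<upsilon>)) F"
proof -
  have "memm \<sigma> (sbm_weights (Q n) \<upsilon>) N l A C (Q n) \<upsilon> = ext_ln (likelihood N l A C (Q n) \<upsilon>)" for n
  proof (rule memm_sbm_weights[OF A C _ signs])
    show "linking_probs_in {0..1} N l \<upsilon> (Q n)"
      by (rule linking_probs_mono[OF Q[rule_format]]) auto
    show "likelihood N l A C (Q n) \<upsilon> \<noteq> 0"
      using Q by (simp add: likelihood_nonzero)
  qed
  then show ?thesis
    by (simp add: isCont_tendsto_compose[OF isCont_ext_ln tendsto_likelihood[OF lim]])
qed

section \<open>The sufficient condition for being discriminative\<close>

lemma discriminative_sbm_weights:
  assumes L: "0 \<le> L" "L < 1" and P: "linking_probs_in {L..1 - L} N l \<upsilon> P"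
    and signs: "lam_a \<sigma> = 1" "lam_d \<sigma> = 1" "lam_e \<sigma> = 1" "lam_h \<sigma> = 1"
  shows "discriminative_condition log_ratio (\<lambda>x. ereal (x - L)) L 1
           (retained_weights N l \<sigma> (sbm_weights P \<upsilon>))"
proof -
  have sub: "{L..1} \<subseteq> {0..1}"
    using L by auto
  \<comment> \<open>The range [L, 1 - L] is symmetric under p to 1 - p, so the arguments of all four
    retained weight families stay in [L, 1].\<close>
  have bnd: "p \<in> {L..1} \<and> 1 - p \<in> {L..1}" if "p \<in> {L..1 - L}" for p
    using that L by auto
  have "\<exists>x\<in>{L..1}. \<omega> = (if lam = 1 then log_ratio x else ereal (x - L))"
    if "(lam, \<omega>) \<in> retained_weights N l \<sigma> (sbm_weights P \<upsilon>)" for lam \<omega>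
  proof -
    have "lam = 1 \<and> \<omega> \<in> log_ratio ` {L..1}"
      using that bnd[OF linking_probs_intra[OF P]] bnd[OF linking_probs_inter[OF P]]
      unfolding retained_weights_def signed_weights_def sbm_weights_def memm_weights.select_convs signs
      by (auto simp del: atLeastAtMost_iff)
    then show ?thesis
      by auto
  qed
  \<comment> \<open>The witness for \<open>F2\<close> is the identity shifted to vanish at L, which
    matches \<open>log_ratio 1 = 0\<close> and gives \<open>F1 U = F2 L\<close>.\<close>
  moreover have "continuous_on {L..1} (\<lambda>x. ereal (x - L))"
    by (intro continuous_intros)
  moreover have "strict_mono_on {L..1} (\<lambda>x. ereal (x - L))"
    by (simp add: strict_mono_on_def)
  moreover have "strict_mono_on {L..1} log_ratio"
    using strict_mono_on_log_ratio sub by (meson strict_mono_onD strict_mono_onI subsetD)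
  ultimately show ?thesis
    using L continuous_on_subset[OF continuous_on_log_ratio sub]
    by (auto simp: discriminative_condition_def zero_ereal_def split del: if_split)
qed

(* When the likelihood vanishes, the objective contains the undefined product (log 0 / 0) * 0;
   the second conjunct therefore excludes this case, and the third covers it by reading the
   objective as a limit from linking probabilities in (0, 1).  For the discriminative condition,
   [L, U] = [0, 1] always applies, with F1 0 = -\<infinity>; on [L, 1] with L > 0, F1 is finite. *)
theorem mainTheorem2:
  fixes N l :: nat
    and A C :: "nat \<Rightarrow> nat \<Rightarrow> nat \<Rightarrow> nat"
    and \<upsilon> :: "nat \<Rightarrow> nat \<Rightarrow> 'c"
    and P :: "'c \<Rightarrow> 'c \<Rightarrow> real"
    and \<sigma> :: memm_signs
  assumes A: "\<And>i j s. (i, j, s) \<in> intra_index N l \<Longrightarrow> A i j s \<in> {0, 1}"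
    and C: "\<And>i s r. (i, s, r) \<in> inter_index N l \<Longrightarrow> C i s r \<in> {0, 1}"
    and P: "linking_probs_in {0..1} N l \<upsilon> P"
    and signs_retained: "lam_a \<sigma> = 1" "lam_d \<sigma> = 1" "lam_e \<sigma> = 1" "lam_h \<sigma> = 1"
    and signs_omitted: "lam_b \<sigma> \<in> {1, -1}" "lam_c \<sigma> \<in> {1, -1}"
      "lam_f \<sigma> \<in> {1, -1}" "lam_g \<sigma> \<in> {1, -1}"
  shows
    "ext_ln (likelihood N l A C P \<upsilon>) =
        (\<Sum>(i, j, s)\<in>intra_index N l. ereal (real (A i j s)) * ext_ln (P (\<upsilon> i s) (\<upsilon> j s)))
      + (\<Sum>(i, j, s)\<in>intra_index N l. ereal (1 - real (A i j s)) * ext_ln (1 - P (\<upsilon> i s) (\<upsilon> j s)))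
      + (\<Sum>(i, s, r)\<in>inter_index N l. ereal (real (C i s r)) * ext_ln (P (\<upsilon> i s) (\<upsilon> i r)))
      + (\<Sum>(i, s, r)\<in>inter_index N l. ereal (1 - real (C i s r)) * ext_ln (1 - P (\<upsilon> i s) (\<upsilon> i r)))
     \<and>
     (likelihood N l A C P \<upsilon> \<noteq> 0 \<longrightarrow>
        memm \<sigma> (sbm_weights P \<upsilon>) N l A C P \<upsilon> = ext_ln (likelihood N l A C P \<upsilon>))
     \<and>
     (\<forall>Q :: nat \<Rightarrow> 'c \<Rightarrow> 'c \<Rightarrow> real.
        (\<forall>n. linking_probs_in {0<..<1} N l \<upsilon> (Q n)) \<longrightarrow>
        (\<forall>i\<in>{1..N}. \<forall>j\<in>{1..N}. \<forall>s\<in>{1..l}. \<forall>r\<in>{1..l}.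
           (\<lambda>n. Q n (\<upsilon> i s) (\<upsilon> j r)) \<longlonglongrightarrow> P (\<upsilon> i s) (\<upsilon> j r)) \<longrightarrow>
        (\<lambda>n. memm \<sigma> (sbm_weights (Q n) \<upsilon>) N l A C (Q n) \<upsilon>)
          \<longlonglongrightarrow> ext_ln (likelihood N l A C P \<upsilon>))
     \<and>
     (\<exists>F2. discriminative_condition log_ratio F2 0 1
              (retained_weights N l \<sigma> (sbm_weights P \<upsilon>)))
     \<and>
     (\<forall>L\<in>{0<..<1}. linking_probs_in {L..1 - L} N l \<upsilon> P \<longrightarrow>
        (\<exists>F2. discriminative_condition log_ratio F2 L 1
                 (retained_weights N l \<sigma> (sbm_weights P \<upsilon>))))
     \<and>
     continuous_on {0<..1} (\<lambda>x::real. ln x / x) \<and>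
     strict_mono_on {0<..1} (\<lambda>x::real. ln x / x) \<and>
     (\<forall>x\<in>{0<..1}. log_ratio x = ereal (ln x / x))
     \<and>
     (\<forall>x\<in>{0..1}. log_ratio x \<le> 0 \<and> (log_ratio x = 0 \<longleftrightarrow> x = 1))
     \<and>
     (\<forall>(i, j, s)\<in>intra_index N l.
        wt_a (sbm_weights P \<upsilon>) i j s \<le> 0 \<and>
        (wt_a (sbm_weights P \<upsilon>) i j s = 0 \<longleftrightarrow> P (\<upsilon> i s) (\<upsilon> j s) = 1) \<and>
        wt_d (sbm_weights P \<upsilon>) i j s \<le> 0 \<and>
        (wt_d (sbm_weights P \<upsilon>) i j s = 0 \<longleftrightarrow> 1 - P (\<upsilon> i s) (\<upsilon> j s) = 1))
     \<and>
     (\<forall>(i, s, r)\<in>inter_index N l.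
        wt_e (sbm_weights P \<upsilon>) i s r \<le> 0 \<and>
        (wt_e (sbm_weights P \<upsilon>) i s r = 0 \<longleftrightarrow> P (\<upsilon> i s) (\<upsilon> i r) = 1) \<and>
        wt_h (sbm_weights P \<upsilon>) i s r \<le> 0 \<and>
        (wt_h (sbm_weights P \<upsilon>) i s r = 0 \<longleftrightarrow> 1 - P (\<upsilon> i s) (\<upsilon> i r) = 1))"
proof (intro conjI)
  note signs = signs_retained
  show "ext_ln (likelihood N l A C P \<upsilon>) =
        (\<Sum>(i, j, s)\<in>intra_index N l. ereal (real (A i j s)) * ext_ln (P (\<upsilon> i s) (\<upsilon> j s)))
      + (\<Sum>(i, j, s)\<in>intra_index N l. ereal (1 - real (A i j s)) * ext_ln (1 - P (\<upsilon> i s) (\<upsilon> j s)))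
      + (\<Sum>(i, s, r)\<in>inter_index N l. ereal (real (C i s r)) * ext_ln (P (\<upsilon> i s) (\<upsilon> i r)))
      + (\<Sum>(i, s, r)\<in>inter_index N l. ereal (1 - real (C i s r)) * ext_ln (1 - P (\<upsilon> i s) (\<upsilon> i r)))"
    by (rule ext_ln_likelihood_expand[OF A C P])
  show "likelihood N l A C P \<upsilon> \<noteq> 0 \<longrightarrow>
        memm \<sigma> (sbm_weights P \<upsilon>) N l A C P \<upsilon> = ext_ln (likelihood N l A C P \<upsilon>)"
    by (intro impI memm_sbm_weights[OF A C P signs])
  show "\<forall>Q. (\<forall>n. linking_probs_in {0<..<1} N l \<upsilon> (Q n)) \<longrightarrow>
        (\<forall>i\<in>{1..N}. \<forall>j\<in>{1..N}. \<forall>s\<in>{1..l}. \<forall>r\<in>{1..l}.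
           (\<lambda>n. Q n (\<upsilon> i s) (\<upsilon> j r)) \<longlonglongrightarrow> P (\<upsilon> i s) (\<upsilon> j r)) \<longrightarrow>
        (\<lambda>n. memm \<sigma> (sbm_weights (Q n) \<upsilon>) N l A C (Q n) \<upsilon>)
          \<longlonglongrightarrow> ext_ln (likelihood N l A C P \<upsilon>)"
    by (intro allI impI, rule tendsto_memm_sbm_weights[OF A C signs])
  show "\<exists>F2. discriminative_condition log_ratio F2 0 1
              (retained_weights N l \<sigma> (sbm_weights P \<upsilon>))"
    \<comment> \<open>For L = 0 the range [L, 1 - L] is the full unit interval, so the assumption on
      the linking probabilities suffices.\<close>
    using discriminative_sbm_weights[of 0 N l \<upsilon> P \<sigma>] P signs by auto
  show "\<forall>L\<in>{0<..<1}. linking_probs_in {L..1 - L} N l \<upsilon> P \<longrightarrow>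
        (\<exists>F2. discriminative_condition log_ratio F2 L 1
                 (retained_weights N l \<sigma> (sbm_weights P \<upsilon>)))"
    by (intro ballI impI exI, rule discriminative_sbm_weights[OF _ _ _ signs]) auto
  show "continuous_on {0<..1} (\<lambda>x::real. ln x / x)"
    by (rule continuous_on_ln_div)
  show "strict_mono_on {0<..1} (\<lambda>x::real. ln x / x)"
    by (rule strict_mono_on_ln_div)
  show "\<forall>x\<in>{0<..1}. log_ratio x = ereal (ln x / x)"
    by (simp add: log_ratio_pos)
  show "\<forall>x\<in>{0..1}. log_ratio x \<le> 0 \<and> (log_ratio x = 0 \<longleftrightarrow> x = 1)"
    using log_ratio_nonpos by blast
  \<comment> \<open>Since 1 - p again lies in [0, 1], the one-variable bound serves a and d, and
    likewise e and h.\<close>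
  have weight: "log_ratio p \<le> 0 \<and> (log_ratio p = 0 \<longleftrightarrow> p = 1) \<and>
      log_ratio (1 - p) \<le> 0 \<and> (log_ratio (1 - p) = 0 \<longleftrightarrow> 1 - p = 1)" if "p \<in> {0..1}" for p
    using that log_ratio_nonpos[of p] log_ratio_nonpos[of "1 - p"] by simp
  show "\<forall>(i, j, s)\<in>intra_index N l.
        wt_a (sbm_weights P \<upsilon>) i j s \<le> 0 \<and>
        (wt_a (sbm_weights P \<upsilon>) i j s = 0 \<longleftrightarrow> P (\<upsilon> i s) (\<upsilon> j s) = 1) \<and>
        wt_d (sbm_weights P \<upsilon>) i j s \<le> 0 \<and>
        (wt_d (sbm_weights P \<upsilon>) i j s = 0 \<longleftrightarrow> 1 - P (\<upsilon> i s) (\<upsilon> j s) = 1)"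
    unfolding sbm_weights_def memm_weights.select_convs
    using weight[OF linking_probs_intra[OF P]] by blast
  show "\<forall>(i, s, r)\<in>inter_index N l.
        wt_e (sbm_weights P \<upsilon>) i s r \<le> 0 \<and>
        (wt_e (sbm_weights P \<upsilon>) i s r = 0 \<longleftrightarrow> P (\<upsilon> i s) (\<upsilon> i r) = 1) \<and>
        wt_h (sbm_weights P \<upsilon>) i s r \<le> 0 \<and>
        (wt_h (sbm_weights P \<upsilon>) i s r = 0 \<longleftrightarrow> 1 - P (\<upsilon> i s) (\<upsilon> i r) = 1)"
    unfolding sbm_weights_def memm_weights.select_convs
    using weight[OF linking_probs_inter[OF P]] by blast
qed

end
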